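(* Let $T$ be a (finite) tree. Then $\Phi_T'(x)>0$ for all real $x\in(-1,0)$.
   Context: For a finite tree $T$ of order $n$, $s_k(T)$ denotes the number of subtrees (connected induced subgraphs) of $T$ of order $k$, and the subtree polynomial of $T$ is $\Phi_T(x)=\sum_{k=1}^n s_k(T)x^k$. *)

theory Defs
  imports
    "HOL-Computational_Algebra.Polynomial"
    "Graph_Theory.Digraph_Component"
begin

text \<open>
  A finite simple graph is a \<^locale>\<open>pair_graph\<close>, i.e. a finite, loop-free, symmetric
  digraph without parallel arcs. The library predicate \<^const>\<open>tree\<close> is not usable for such
  graphs: it forbids every directed cycle, and each undirected edge already yields the directed
  cycle a, b, a of length 2. The cycles of the underlying undirected graph are precisely the
  directed cycles of length at least 3. Connectedness includes having at least one vertex.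
\<close>

definition undirected_tree :: "'a pair_pre_digraph \<Rightarrow> bool" where
  "undirected_tree T \<longleftrightarrow>
     pair_graph T \<and> connected (with_proj T) \<and>
     \<not> (\<exists>p. pre_digraph.cycle (with_proj T) p \<and> 3 \<le> length p)"

definition subtrees_of_order :: "'a pair_pre_digraph \<Rightarrow> nat \<Rightarrow> 'a pair_pre_digraph set" where
  "subtrees_of_order T k =
     {S. induced_subgraph (with_proj S) (with_proj T) \<and> connected (with_proj S) \<and>
         card (pverts S) = k}"

definition subtree_poly :: "'a pair_pre_digraph \<Rightarrow> real poly" where
  "subtree_poly T =
     (\<Sum>k = 1..card (pverts T). monom (real (card (subtrees_of_order T k))) k)"

end

theory Submission
  imports Defs
begin

text \<open>
  Counting pairs of a subtree and one of its vertices shows that \<open>x \<Phi>'(x)\<close> is the sum over all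
  vertices \<open>v\<close> of \<open>F v = (\<Sum>S. x ^ card S)\<close>, where \<open>S\<close> ranges over the subtrees containing \<open>v\<close>.
  It therefore suffices that \<open>-1 < F v < 0\<close> for \<open>-1 < x < 0\<close>, and this holds in every forest, by
  induction on the number of edges: if \<open>v\<close> is isolated then \<open>F v = x\<close>; otherwise deleting an edge
  \<open>vc\<close> gives \<open>F v = F' v * (1 + F' c)\<close>, since a subtree containing \<open>v\<close> and \<open>c\<close> is a disjoint union
  of a subtree containing \<open>v\<close> and one containing \<open>c\<close>.
\<close>

section \<open>Connected vertex sets through a root, and acyclicity\<close>

text \<open>Vertex sets stand in for subtrees, so that \<open>E\<close> can lose edges while
  \<open>V\<close> stays fixed. For symmetric \<open>E\<close>, reaching all of \<open>S\<close>
  from \<open>v\<close> inside \<open>S\<close> amounts to connectedness.\<close>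

definition rooted_connected_sets :: "'a set \<Rightarrow> 'a rel \<Rightarrow> 'a \<Rightarrow> 'a set set" where
  "rooted_connected_sets V E v = {S. S \<subseteq> V \<and> v \<in> S \<and> (\<forall>u\<in>S. (v, u) \<in> rtrancl_on S E)}"

text \<open>Acyclicity in a form that passes to every subset of the edges. Both orientations are
  removed because one undirected edge is a pair of arcs.\<close>

definition all_bridges :: "'a rel \<Rightarrow> bool" where
  "all_bridges E \<longleftrightarrow> (\<forall>u v. (u, v) \<in> E \<longrightarrow> (u, v) \<notin> (E - {(u, v), (v, u)})\<^sup>*)"

lemma all_bridges_mono:
  assumes "all_bridges E" and "E' \<subseteq> E"
  shows "all_bridges E'"
  unfolding all_bridges_def
proof (intro allI impI notI)
  fix u v assume "(u, v) \<in> E'" and "(u, v) \<in> (E' - {(u, v), (v, u)})\<^sup>*"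
  moreover have "(E' - {(u, v), (v, u)})\<^sup>* \<subseteq> (E - {(u, v), (v, u)})\<^sup>*"
    using assms(2) by (intro rtrancl_mono) auto
  ultimately show False
    using assms unfolding all_bridges_def by blast
qed

lemma finite_rooted_connected_sets:
  "finite V \<Longrightarrow> finite (rooted_connected_sets V E v)"
  by (rule finite_subset[of _ "Pow V"]) (auto simp: rooted_connected_sets_def)

text \<open>Each vertex on a path from \<open>a\<close> is itself reachable from \<open>a\<close>,
  so the path never leaves the component of \<open>a\<close>. This makes components rooted connected
  sets.\<close>

lemma rtrancl_on_closed_subset:
  assumes "(a, b) \<in> rtrancl_on F r"
  shows "(a, b) \<in> rtrancl_on {u \<in> F. (a, u) \<in> rtrancl_on F r} r"
  using assms
proof (induction rule: rtrancl_on_induct)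
  case base
  then show ?case by auto
next
  case (step y z)
  then show ?case
    by (intro rtrancl_on_into_rtrancl_on[OF step.IH step.hyps(2)])
       (auto intro: rtrancl_on_into_rtrancl_on)
qed

lemma rooted_connected_sets_isolated:
  assumes "v \<in> V" and "\<And>c. (v, c) \<notin> E"
  shows "rooted_connected_sets V E v = {{v}}"
proof -
  have "u = v" if "(v, u) \<in> rtrancl_on S E" for u S
    using that assms(2) by (auto elim: converse_rtrancl_on_cases)
  then show ?thesis
    using assms(1) unfolding rooted_connected_sets_def by auto
qed

section \<open>Deleting a bridge\<close>

locale bridge =
  fixes V :: "'a set" and E :: "'a rel" and v c :: 'a
  assumes E_sym: "sym E" and edge: "(v, c) \<in> E"
    and not_reachable: "(v, c) \<notin> (E - {(v, c), (c, v)})\<^sup>*"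
begin

abbreviation "E' \<equiv> E - {(v, c), (c, v)}"

lemma rooted_connected_sets_reachable:
  "S \<in> rooted_connected_sets V E' w \<Longrightarrow> u \<in> S \<Longrightarrow> (w, u) \<in> E'\<^sup>*"
  unfolding rooted_connected_sets_def by (auto intro: rtrancl_on_rtranclI)

lemma sym_del: "sym (E'\<^sup>*)"
  using E_sym by (intro sym_rtrancl) (auto simp: sym_def)

text \<open>By symmetry, a common \<open>u\<close> would link \<open>v\<close> to \<open>c\<close>
  without the bridge.\<close>

lemma not_reachable_both: "(v, u) \<in> E'\<^sup>* \<Longrightarrow> (c, u) \<notin> E'\<^sup>*"
  using not_reachable sym_del by (metis rtrancl_trans symD)

text \<open>If \<open>c\<close> is outside \<open>S\<close>, no path inside \<open>S\<close> can use
  the edge \<open>vc\<close>; conversely, \<open>E'\<close> never leads from \<open>v\<close> to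
  \<open>c\<close>.\<close>

lemma rooted_connected_sets_avoiding:
  "{S \<in> rooted_connected_sets V E v. c \<notin> S} = rooted_connected_sets V E' v"
proof (intro set_eqI iffI)
  fix S assume S: "S \<in> {S \<in> rooted_connected_sets V E v. c \<notin> S}"
  have "(v, u) \<in> rtrancl_on S E'" if "(v, u) \<in> rtrancl_on S E" for u
    using that
  proof (induction rule: rtrancl_on_induct)
    case (step y z)
    then show ?case
      using S by (intro rtrancl_on_into_rtrancl_on[OF step.IH]) auto
  qed auto
  then show "S \<in> rooted_connected_sets V E' v"
    using S by (auto simp: rooted_connected_sets_def)
next
  fix S assume S: "S \<in> rooted_connected_sets V E' v"
  have "c \<notin> S"
    using rooted_connected_sets_reachable[OF S] not_reachable by auto
  moreover have "S \<in> rooted_connected_sets V E v"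
    using S by (auto simp: rooted_connected_sets_def intro: rtrancl_on_mono[of E' E S S])
  ultimately show "S \<in> {S \<in> rooted_connected_sets V E v. c \<notin> S}"
    by simp
qed

lemma rooted_connected_sets_disjoint:
  assumes "S1 \<in> rooted_connected_sets V E' v" "S2 \<in> rooted_connected_sets V E' c"
  shows "S1 \<inter> S2 = {}"
  using assms rooted_connected_sets_reachable not_reachable_both by blast

text \<open>The inverse cuts \<open>S\<close> at the bridge into the vertices still joined to
  \<open>v\<close> and those still joined to \<open>c\<close>.\<close>

lemma bij_betw_rooted_connected_sets_Un:
  "bij_betw (\<lambda>(S1, S2). S1 \<union> S2)
     (rooted_connected_sets V E' v \<times> rooted_connected_sets V E' c)
     {S \<in> rooted_connected_sets V E v. c \<in> S}"
  unfolding bij_betw_def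
proof (intro conjI set_eqI iffI)
  show "inj_on (\<lambda>(S1, S2). S1 \<union> S2) (rooted_connected_sets V E' v \<times> rooted_connected_sets V E' c)"
  proof (rule inj_onI, clarify)
    fix S1 S2 R1 R2
    assume S: "S1 \<in> rooted_connected_sets V E' v" "S2 \<in> rooted_connected_sets V E' c"
      and R: "R1 \<in> rooted_connected_sets V E' v" "R2 \<in> rooted_connected_sets V E' c"
      and eq: "S1 \<union> S2 = R1 \<union> R2"
    \<comment> \<open>Disjointness also holds crosswise, so the union determines both parts.\<close>
    have "S1 \<inter> R2 = {}" "R1 \<inter> S2 = {}" "S1 \<inter> S2 = {}" "R1 \<inter> R2 = {}"
      using S R rooted_connected_sets_disjoint by blast+
    then show "S1 = R1 \<and> S2 = R2"
      using eq by blast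
  qed
next
  fix S
  assume "S \<in> (\<lambda>(S1, S2). S1 \<union> S2) `
    (rooted_connected_sets V E' v \<times> rooted_connected_sets V E' c)"
  then obtain S1 S2 where S: "S = S1 \<union> S2"
    and S1: "S1 \<in> rooted_connected_sets V E' v" and S2: "S2 \<in> rooted_connected_sets V E' c"
    by auto
  have v: "(v, u) \<in> rtrancl_on S E" if "u \<in> S1" for u
    using that S1 S by (auto simp: rooted_connected_sets_def intro: rtrancl_on_mono[of E' E S1])
  have c: "(c, u) \<in> rtrancl_on S E" if "u \<in> S2" for u
    using that S2 S by (auto simp: rooted_connected_sets_def intro: rtrancl_on_mono[of E' E S2])
  have "v \<in> S1" "c \<in> S2"
    using S1 S2 by (auto simp: rooted_connected_sets_def)
  \<comment> \<open>Cross the bridge from \<open>v\<close> first, then continue inside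
    \<open>S2\<close>.\<close>
  then have "(v, u) \<in> rtrancl_on S E" if "u \<in> S2" for u
    using c[OF that] edge S by (auto intro: converse_rtrancl_on_into_rtrancl_on)
  then show "S \<in> {S \<in> rooted_connected_sets V E v. c \<in> S}"
    using v S S1 S2 by (auto simp: rooted_connected_sets_def)
next
  fix S assume "S \<in> {S \<in> rooted_connected_sets V E v. c \<in> S}"
  then have SV: "S \<subseteq> V" "v \<in> S" "c \<in> S" and reach: "\<And>u. u \<in> S \<Longrightarrow> (v, u) \<in> rtrancl_on S E"
    by (auto simp: rooted_connected_sets_def)
  define part where "part w = {u \<in> S. (w, u) \<in> rtrancl_on S E'}" for w
  have part: "part w \<in> rooted_connected_sets V E' w" if "w \<in> S" for w
    using that SV rtrancl_on_closed_subset[of w _ S E']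
    by (auto simp: part_def rooted_connected_sets_def)
  have "u \<in> part v \<union> part c" if "(v, u) \<in> rtrancl_on S E" for u
    using that
  proof (induction rule: rtrancl_on_induct)
    case base
    then show ?case by (auto simp: part_def)
  next
    case (step y z)
    show ?case
    proof (cases "(y, z) \<in> E'")
      case True
      then show ?thesis
        using step by (auto simp: part_def intro: rtrancl_on_into_rtrancl_on)
    next
      case False
      \<comment> \<open>Only the two arcs of the bridge were deleted, so \<open>z\<close> is one of
        its ends and lies in its own part by the empty path.\<close>
      then have "z = v \<or> z = c"
        using step by auto
      then show ?thesis
        using SV by (auto simp: part_def)
    qed
  qed
  then have "S = part v \<union> part c"
    using reach by (auto simp: part_def)
  then show "S \<in> (\<lambda>(S1, S2). S1 \<union> S2) `
    (rooted_connected_sets V E' v \<times> rooted_connected_sets V E' c)"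
    using part SV by (intro image_eqI[of _ _ "(part v, part c)"]) auto
qed

text \<open>Sets without \<open>c\<close> give the term 1 of the second factor. Sets with
  \<open>c\<close> give the product of the two sums, since sizes add over disjoint unions.\<close>

lemma sum_rooted_connected_sets_bridge:
  fixes x :: "'b::comm_ring_1"
  assumes "finite V"
  shows "(\<Sum>S\<in>rooted_connected_sets V E v. x ^ card S) =
    (\<Sum>S\<in>rooted_connected_sets V E' v. x ^ card S) *
    (1 + (\<Sum>S\<in>rooted_connected_sets V E' c. x ^ card S))"
    (is "?F = ?Fv * (1 + ?Fc)")
proof -
  let ?R = "rooted_connected_sets V E v"
  have "card (S1 \<union> S2) = card S1 + card S2"
    if "S1 \<in> rooted_connected_sets V E' v" "S2 \<in> rooted_connected_sets V E' c" for S1 S2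
    using rooted_connected_sets_disjoint[OF that] that assms
    by (intro card_Un_disjoint) (auto simp: rooted_connected_sets_def intro: finite_subset)
  then have "(\<Sum>S | S \<in> ?R \<and> c \<in> S. x ^ card S) =
    (\<Sum>(S1, S2)\<in>rooted_connected_sets V E' v \<times> rooted_connected_sets V E' c.
      x ^ card S1 * x ^ card S2)"
    unfolding sum.reindex_bij_betw[OF bij_betw_rooted_connected_sets_Un, symmetric]
    by (intro sum.cong) (auto simp: power_add)
  also have "\<dots> = ?Fv * ?Fc"
    by (simp add: sum_product sum.cartesian_product)
  finally have "(\<Sum>S | S \<in> ?R \<and> c \<in> S. x ^ card S) = ?Fv * ?Fc" .
  moreover have "?F = (\<Sum>S | S \<in> ?R \<and> c \<in> S. x ^ card S) + (\<Sum>S | S \<in> ?R \<and> c \<notin> S. x ^ card S)"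
    using finite_rooted_connected_sets[OF assms, of E v]
    by (subst sum.union_disjoint[symmetric]) (auto intro!: sum.cong)
  ultimately show ?thesis
    by (simp add: rooted_connected_sets_avoiding algebra_simps)
qed

end

section \<open>Bounds on the rooted sums\<close>

lemma sum_rooted_connected_sets_bounds:
  fixes x :: real
  assumes "finite E" and "sym E" and "all_bridges E" and "finite V" and "E \<subseteq> V \<times> V" and "v \<in> V"
    and x: "-1 < x" "x < 0"
  shows "(\<Sum>S\<in>rooted_connected_sets V E v. x ^ card S) \<in> {-1<..<0}"
  using assms(1-6)
proof (induction E arbitrary: v rule: finite_psubset_induct)
  case (psubset E)
  show ?case
  proof (cases "\<exists>c. (v, c) \<in> E")
    case False
    then show ?thesis
      using rooted_connected_sets_isolated[of v V E] psubset.prems x by simp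
  next
    case True
    then obtain c where c: "(v, c) \<in> E" by blast
    interpret bridge V E v c
      using c psubset.prems by unfold_locales (auto simp: all_bridges_def)
    let ?f = "\<lambda>w. \<Sum>S\<in>rooted_connected_sets V E' w. x ^ card S"
    have "?f w \<in> {-1<..<0}" if "w \<in> V" for w
      using that psubset.prems c
      by (intro psubset.IH) (auto simp: sym_def intro: all_bridges_mono)
    then have v: "-1 < ?f v" "?f v < 0" and "-1 < ?f c" "?f c < 0"
      using psubset.prems c by auto
    \<comment> \<open>The factor \<open>1 + ?f c\<close> lies strictly between 0 and 1: it keeps the
      sign of \<open>?f v\<close> and moves it towards 0. Its positivity is why the induction
      carries the lower bound -1.\<close>
    then have "?f v * (1 + ?f c) < 0" "?f v * 1 \<le> ?f v * (1 + ?f c)"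
      by (auto intro!: mult_neg_pos mult_left_mono_neg)
    with v have "-1 < ?f v * (1 + ?f c)" "?f v * (1 + ?f c) < 0"
      by linarith+
    then show ?thesis
      using sum_rooted_connected_sets_bridge[OF psubset.prems(3), of x] by simp
  qed
qed

section \<open>From library graphs to edge relations\<close>

text \<open>A detour around an edge closes up with that edge to a cycle of length at least
  3.\<close>

lemma (in pair_graph) all_bridges_if_no_cycle:
  assumes "\<And>p. cycle p \<Longrightarrow> length p < 3"
  shows "all_bridges (parcs G)"
  unfolding all_bridges_def
proof (intro allI impI notI)
  fix u v
  assume uv: "(u, v) \<in> parcs G" and reach: "(u, v) \<in> (parcs G - {(u, v), (v, u)})\<^sup>*"
  have "\<exists>p. awalk u p w \<and> set p \<subseteq> parcs G - {(u, v), (v, u)}"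
    if "(u, w) \<in> (parcs G - {(u, v), (v, u)})\<^sup>*" for w
    using that
  proof induction
    case base
    then show ?case
      using uv by (intro exI[of _ "[]"]) (auto simp: awalk_Nil_iff dest: in_arcsD1)
  next
    case (step y z)
    then obtain p where p: "awalk u p y" "set p \<subseteq> parcs G - {(u, v), (v, u)}"
      by blast
    have "awalk y [(y, z)] z"
      using step.hyps by (auto simp: awalk_simps dest: wellformed')
    then show ?case
      using p step.hyps by (intro exI[of _ "p @ [(y, z)]"]) (auto intro: awalk_appendI)
  qed
  then obtain p where p: "awalk u p v" "set p \<subseteq> parcs G - {(u, v), (v, u)}"
    using reach by blast
  \<comment> \<open>Shortening the walk to a path makes its vertices distinct, as a cycle
    demands.\<close>
  define q where "q = awalk_to_apath p"
  have q: "apath u q v" "set q \<subseteq> parcs G - {(u, v), (v, u)}"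
    using p apath_awalk_to_apath awalk_to_apath_subset unfolding q_def by blast+
  have "u \<noteq> v"
    using uv by (rule no_loops')
  \<comment> \<open>Length 0 would force \<open>u = v\<close>, and length 1 would use the deleted
    arc \<open>(u, v)\<close>.\<close>
  have "length q \<ge> 2"
  proof (rule ccontr)
    assume "\<not> length q \<ge> 2"
    then consider "q = []" | e where "q = [e]"
      by (cases q; cases "tl q") auto
    then show False
      using q \<open>u \<noteq> v\<close> by cases (auto simp: apath_def awalk_simps)
  qed
  have "cycle ((v, u) # q)"
    unfolding cycle_def
    using q uv by (intro exI[of _ v]) (auto simp: apath_def awalk_simps arcs_symmetric dest: wellformed')
  then show False
    using assms[of "(v, u) # q"] \<open>length q \<ge> 2\<close> by simp
qed

text \<open>The symmetric closure in \<open>connected\<close> adds nothing, as \<open>S\<close>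
  inherits symmetry from \<open>G\<close>; and a path of \<open>G\<close> inside
  \<open>pverts S\<close> uses only arcs of the induced \<open>S\<close>.\<close>

lemma (in pair_graph) connected_induced_iff:
  assumes "induced_subgraph (with_proj S) (with_proj G)"
  shows "connected (with_proj S) \<longleftrightarrow>
    pverts S \<noteq> {} \<and> (\<forall>u\<in>pverts S. \<forall>v\<in>pverts S. (u, v) \<in> rtrancl_on (pverts S) (parcs G))"
proof -
  have arcs: "parcs S = {e \<in> parcs G. fst e \<in> pverts S \<and> snd e \<in> pverts S}"
    using assms by (auto simp: induced_subgraph_def)
  have "parcs (mk_symmetric (with_proj S)) = parcs S"
    using arcs arcs_symmetric by (auto simp: parcs_mk_symmetric)
  moreover have "(u, v) \<in> rtrancl_on (pverts S) (parcs S) \<longleftrightarrow> (u, v) \<in> rtrancl_on (pverts S) (parcs G)"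
    for u v
  proof
    assume "(u, v) \<in> rtrancl_on (pverts S) (parcs G)"
    then show "(u, v) \<in> rtrancl_on (pverts S) (parcs S)"
      by (induction rule: rtrancl_on_induct) (auto simp: arcs intro: rtrancl_on_into_rtrancl_on)
  qed (auto simp: arcs intro: rtrancl_on_mono[of "parcs S"])
  ultimately show ?thesis
    by (simp add: connected_def strongly_connected_def reachable_def)
qed

text \<open>An induced subgraph is recovered from its vertices by taking all arcs of
  \<open>G\<close> between them.\<close>

lemma (in pair_graph) bij_betw_pverts_subtrees:
  "bij_betw pverts (subtrees_of_order G k)
     {W. W \<subseteq> pverts G \<and> W \<noteq> {} \<and> (\<forall>u\<in>W. \<forall>v\<in>W. (u, v) \<in> rtrancl_on W (parcs G)) \<and> card W = k}"
  (is "bij_betw _ _ ?C")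
proof (rule bij_betwI[where g = "\<lambda>W. \<lparr>pverts = W, parcs = {e \<in> parcs G. fst e \<in> W \<and> snd e \<in> W}\<rparr>"])
  let ?g = "\<lambda>W. \<lparr>pverts = W, parcs = {e \<in> parcs G. fst e \<in> W \<and> snd e \<in> W}\<rparr>"
  show "pverts \<in> subtrees_of_order G k \<rightarrow> ?C"
    using connected_induced_iff
    by (auto simp: subtrees_of_order_def induced_subgraph_def subgraph_def)
  have "induced_subgraph (with_proj (?g W)) (with_proj G)" if "W \<subseteq> pverts G" for W
    using that wf_digraph
    by (auto simp: induced_subgraph_def subgraph_def wf_digraph_wp_iff pair_wf_digraph_def)
  then show "?g \<in> ?C \<rightarrow> subtrees_of_order G k"
    using connected_induced_iff[of "?g _"] by (auto simp: subtrees_of_order_def)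
  show "?g (pverts S) = S" if "S \<in> subtrees_of_order G k" for S
    using that by (cases S) (auto simp: subtrees_of_order_def induced_subgraph_def)
qed auto

lemma (in pair_graph) rooted_connected_sets_eq:
  "rooted_connected_sets (pverts G) (parcs G) v =
    {W. W \<subseteq> pverts G \<and> W \<noteq> {} \<and> (\<forall>u\<in>W. \<forall>w\<in>W. (u, w) \<in> rtrancl_on W (parcs G)) \<and> v \<in> W}"
proof -
  have "sym (rtrancl_on W (parcs G))" for W
    using arcs_symmetric by (intro rtrancl_on_sym) (auto simp: sym_def)
  then have "(\<forall>u\<in>W. (v, u) \<in> rtrancl_on W (parcs G)) \<longleftrightarrow>
      (\<forall>u\<in>W. \<forall>w\<in>W. (u, w) \<in> rtrancl_on W (parcs G))" if "v \<in> W" for W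
    using that by (meson rtrancl_on_trans symD)
  then show ?thesis
    unfolding rooted_connected_sets_def by blast
qed

section \<open>Double counting for the derivative\<close>

lemma (in pair_graph) mult_poly_pderiv_subtree_poly:
  "x * poly (pderiv (subtree_poly G)) x =
    (\<Sum>v\<in>pverts G. \<Sum>S\<in>rooted_connected_sets (pverts G) (parcs G) v. x ^ card S)"
proof -
  define C where "C = {W. W \<subseteq> pverts G \<and> W \<noteq> {} \<and>
    (\<forall>u\<in>W. \<forall>v\<in>W. (u, v) \<in> rtrancl_on W (parcs G))}"
  have fin: "finite C"
    using pair_finite_verts by (intro finite_subset[of C "Pow (pverts G)"]) (auto simp: C_def)
  \<comment> \<open>Sizes in this range ensure that grouping \<open>C\<close> by size loses no
    set.\<close>
  have card_C: "card W \<in> {1..card (pverts G)}" if "W \<in> C" for W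
    using that pair_finite_verts card_mono[of "pverts G" W]
    by (auto simp: C_def Suc_le_eq card_gt_0_iff intro: finite_subset)
  have card_subtrees: "card (subtrees_of_order G k) = card {W \<in> C. card W = k}" for k
    using bij_betw_same_card[OF bij_betw_pverts_subtrees[of k]] by (simp add: C_def conj_ac)
  have "x * poly (pderiv (subtree_poly G)) x =
    (\<Sum>k = 1..card (pverts G). real (card {W \<in> C. card W = k}) * (real k * x ^ k))"
    unfolding subtree_poly_def higher_pderiv_sum[where n = 1, simplified] poly_sum sum_distrib_left
  proof (intro sum.cong refl)
    fix k assume "k \<in> {1..card (pverts G)}"
    \<comment> \<open>Since \<open>k\<close> is at least 1, the factor \<open>x\<close> restores the
      exponent lowered by differentiation.\<close>
    then obtain j where "k = Suc j"
      by (cases k) auto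
    then show "x * poly (pderiv (monom (real (card (subtrees_of_order G k))) k)) x =
      real (card {W \<in> C. card W = k}) * (real k * x ^ k)"
      by (simp add: pderiv_monom poly_monom card_subtrees algebra_simps)
  qed
  also have "\<dots> = (\<Sum>k = 1..card (pverts G). \<Sum>W | W \<in> C \<and> card W = k. real (card W) * x ^ card W)"
    by simp
  also have "\<dots> = (\<Sum>W\<in>C. real (card W) * x ^ card W)"
    using fin card_C by (intro sum.group) auto
  \<comment> \<open>The weight \<open>card W\<close> becomes a sum over the vertices of
    \<open>W\<close>, ready for exchanging the sums.\<close>
  also have "\<dots> = (\<Sum>W\<in>C. \<Sum>v | v \<in> pverts G \<and> v \<in> W. x ^ card W)"
  proof (intro sum.cong refl)
    fix W assume "W \<in> C"
    then have "{v. v \<in> pverts G \<and> v \<in> W} = W"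
      by (auto simp: C_def)
    then show "real (card W) * x ^ card W = (\<Sum>v | v \<in> pverts G \<and> v \<in> W. x ^ card W)"
      by simp
  qed
  also have "\<dots> = (\<Sum>v\<in>pverts G. \<Sum>W | W \<in> C \<and> v \<in> W. x ^ card W)"
    using fin pair_finite_verts by (intro sum.swap_restrict) auto
  also have "\<dots> = (\<Sum>v\<in>pverts G. \<Sum>S\<in>rooted_connected_sets (pverts G) (parcs G) v. x ^ card S)"
    by (simp add: rooted_connected_sets_eq C_def conj_ac)
  finally show ?thesis .
qed

theorem theorem3p1:
  fixes T :: "'a pair_pre_digraph" and x :: real
  assumes "undirected_tree T"
    and "-1 < x" and "x < 0"
  shows "poly (pderiv (subtree_poly T)) x > 0"
proof -
  interpret pair_graph T
    using assms(1) by (simp add: undirected_tree_def)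
  have nonempty: "pverts T \<noteq> {}"
    using assms(1) by (auto simp: undirected_tree_def connected_def strongly_connected_def)
  have "all_bridges (parcs T)"
    using assms(1) by (intro all_bridges_if_no_cycle) (auto simp: undirected_tree_def not_le)
  moreover have "parcs T \<subseteq> pverts T \<times> pverts T" and "sym (parcs T)"
    using wellformed' arcs_symmetric by (auto simp: sym_def)
  ultimately have "(\<Sum>S\<in>rooted_connected_sets (pverts T) (parcs T) v. x ^ card S) < 0"
    if "v \<in> pverts T" for v
    using sum_rooted_connected_sets_bounds[of "parcs T" "pverts T" v x]
      that assms(2,3) pair_finite_verts pair_finite_arcs
    by auto
  \<comment> \<open>A sum of negative terms is strictly negative only over a nonempty index
    set.\<close>
  with nonempty
  have "(\<Sum>v\<in>pverts T. \<Sum>S\<in>rooted_connected_sets (pverts T) (parcs T) v. x ^ card S) <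
    (\<Sum>v\<in>pverts T. 0)"
    by (rule sum_strict_mono[OF pair_finite_verts])
  then have "x * poly (pderiv (subtree_poly T)) x < 0"
    by (simp only: mult_poly_pderiv_subtree_poly sum.neutral_const)
  then show ?thesis
    using assms(3) by (simp add: mult_less_0_iff)
qed

end
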